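(* A strong semicomplete composition $Q=T[H_1,\dots,H_t]$ contains a strong spanning semicomplete composition without a 2-cycle (i.e., a spanning subdigraph which is a strong semicomplete composition and has no 2-cycle) if and only if $t\ge 3$.
   Context: Digraphs are finite, without loops or parallel arcs (2-cycles are allowed). A digraph is semicomplete if there is at least one arc between every pair of distinct vertices. Let $T$ be a digraph with vertices $u_1,\dots,u_t$ ($t\ge 2$) and let $H_1,\dots,H_t$ be pairwise disjoint nonempty digraphs. The composition $Q=T[H_1,\dots,H_t]$ is the digraph with vertex set $\bigcup_i V(H_i)$ and arc set $\bigcup_{i=1}^t A(H_i)\cup\{xy : x\in V(H_i),\ y\in V(H_p),\ u_iu_p\in A(T)\}$. It is a semicomplete composition if $T$ is semicomplete. A digraph is strong if for every ordered pair of vertices $(x,y)$ there is a directed path from $x$ to $y$. A 2-cycle is a pair of opposite arcs $xy,yx$.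
   Formalization: The spanning semicomplete composition is required to have the same number t of parts as Q; with the number of parts free, "only if" fails: T a 2-cycle, H_1 a vertex a, H_2 an arc bc has t=2 but contains the 3-cycle abca. *)

theory Defs
  imports "Graph_Theory.Graph_Theory" "HOL-Library.Disjoint_Sets"
begin

definition semicomplete :: "'a pair_pre_digraph \<Rightarrow> bool" where
  "semicomplete G \<longleftrightarrow> pair_digraph G \<and>
     (\<forall>u\<in>pverts G. \<forall>v\<in>pverts G. u \<noteq> v \<longrightarrow> (u, v) \<in> parcs G \<or> (v, u) \<in> parcs G)"

definition has_two_cycle :: "'a pair_pre_digraph \<Rightarrow> bool" where
  "has_two_cycle G \<longleftrightarrow> (\<exists>x y. x \<noteq> y \<and> (x, y) \<in> parcs G \<and> (y, x) \<in> parcs G)"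

text \<open>The digraphs substituted into \<^term>\<open>T\<close> are indexed by the vertices of \<^term>\<open>T\<close>, so the number
  \<open>t\<close> of parts of \<open>T[H\<^sub>1, \<dots>, H\<^sub>t]\<close> is \<^term>\<open>card (pverts T)\<close>; the values of
  \<^term>\<open>H\<close> outside \<^term>\<open>pverts T\<close> play no role.\<close>

definition composition ::
  "'b pair_pre_digraph \<Rightarrow> ('b \<Rightarrow> 'a pair_pre_digraph) \<Rightarrow> 'a pair_pre_digraph" where
  "composition T H =
     \<lparr> pverts = (\<Union>u\<in>pverts T. pverts (H u)),
       parcs = (\<Union>u\<in>pverts T. parcs (H u)) \<union>
               {(x, y). \<exists>u v. (u, v) \<in> parcs T \<and> x \<in> pverts (H u) \<and> y \<in> pverts (H v)} \<rparr>"

definition semicomplete_composition ::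
  "'b pair_pre_digraph \<Rightarrow> ('b \<Rightarrow> 'a pair_pre_digraph) \<Rightarrow> bool" where
  "semicomplete_composition T H \<longleftrightarrow>
     semicomplete T \<and> 2 \<le> card (pverts T) \<and>
     (\<forall>u\<in>pverts T. pair_digraph (H u) \<and> pverts (H u) \<noteq> {}) \<and>
     disjoint_family_on (\<lambda>u. pverts (H u)) (pverts T)"

text \<open>A spanning semicomplete composition of \<open>Q = T[H\<^sub>1, \<dots>, H\<^sub>t]\<close> has the same number \<open>t\<close> of parts as
  the given composition; its parts need not be those of \<open>Q\<close>. The number of parts depends on the
  representation of a digraph as a composition and not just on the digraph, so it has to be
  fixed: the digraph on \<open>a, b, c\<close> with arcs \<open>ab, ba, ac, ca, bc\<close> is a composition of a 2-cycle with
  a single vertex and an arc (\<open>t = 2\<close>), but it contains the 3-cycle \<open>abca\<close>, which is a strong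
  semicomplete composition with three trivial parts.\<close>

definition spanning_semicomplete_composition ::
  "'b pair_pre_digraph \<Rightarrow> ('b \<Rightarrow> 'a pair_pre_digraph) \<Rightarrow>
   'b pair_pre_digraph \<Rightarrow> ('b \<Rightarrow> 'a pair_pre_digraph) \<Rightarrow> bool" where
  "spanning_semicomplete_composition T' H' T H \<longleftrightarrow>
     semicomplete_composition T' H' \<and> card (pverts T') = card (pverts T) \<and>
     spanning (with_proj (composition T' H')) (with_proj (composition T H))"

end

theory Submission
  imports Defs
begin

text \<open>A composition over a semicomplete digraph \<open>T\<close> with at least two vertices is strong iff \<open>T\<close> is,
  whatever the substituted digraphs are; so these may be replaced by arcless ones. With three or
  more vertices, one arc of every 2-cycle of a strong semicomplete digraph can be deleted: if
  neither \<open>xy\<close> nor \<open>yx\<close> can, let \<open>S\<close> be the set reachable from \<open>x\<close> without \<open>xy\<close> and \<open>S'\<close> the set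
  reachable from \<open>y\<close> without \<open>yx\<close>. No arc leaves \<open>S \<inter> S'\<close> or \<open>S \<union> S'\<close>, so \<open>S\<close> and \<open>S'\<close>
  partition the vertices; as \<open>xy\<close> and \<open>yx\<close> are the only arcs between them, both are singletons.
  With two vertices, a strong \<open>T\<close> is itself a 2-cycle.\<close>

section \<open>Deleting an arc of a 2-cycle while keeping reachability\<close>

lemma two_cycle_arc_deletable:
  assumes strong: "\<And>u v. u \<in> V \<Longrightarrow> v \<in> V \<Longrightarrow> (u, v) \<in> A\<^sup>*"
    and A: "A \<subseteq> V \<times> V"
    and semi: "\<And>u v. u \<in> V \<Longrightarrow> v \<in> V \<Longrightarrow> u \<noteq> v \<Longrightarrow> (u, v) \<in> A \<or> (v, u) \<in> A"
    and xy: "(x, y) \<in> A" and yx: "(y, x) \<in> A"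
    and z: "z \<in> V" "z \<noteq> x" "z \<noteq> y"
  shows "A\<^sup>* = (A - {(x, y)})\<^sup>* \<or> A\<^sup>* = (A - {(y, x)})\<^sup>*"
proof (rule ccontr)
  assume neg: "\<not> ?thesis"
  have V: "x \<in> V" "y \<in> V" using xy A by auto
  have redundant: "A\<^sup>* = (A - {e})\<^sup>*" if "e \<in> (A - {e})\<^sup>*" for e
  proof -
    have "A \<subseteq> (A - {e})\<^sup>*" using that by auto
    then show ?thesis by (intro rtrancl_subset) auto
  qed
  define S where "S = (A - {(x, y)})\<^sup>* `` {x}"
  define S' where "S' = (A - {(y, x)})\<^sup>* `` {y}"
  \<comment> \<open>If \<open>y\<close> were in \<open>S\<close>, a path avoiding
    \<open>(x, y)\<close> could replace that arc, and deleting it would preserve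
    \<open>A\<^sup>*\<close>, against \<open>neg\<close>; the case of \<open>S'\<close> is
    symmetric.\<close>
  have notin: "y \<notin> S" "x \<notin> S'"
    using neg redundant unfolding S_def S'_def by auto
  have mem: "x \<in> S" "y \<in> S'" by (auto simp: S_def S'_def)
  have S_step: "b \<in> S" if "a \<in> S" "(a, b) \<in> A" "(a, b) \<noteq> (x, y)" for a b
    using that unfolding S_def by (auto intro: rtrancl_into_rtrancl)
  have S'_step: "b \<in> S'" if "a \<in> S'" "(a, b) \<in> A" "(a, b) \<noteq> (y, x)" for a b
    using that unfolding S'_def by (auto intro: rtrancl_into_rtrancl)
  have closed: "b \<in> W" if "(a, b) \<in> A\<^sup>*" "a \<in> W" "A `` W \<subseteq> W" for a b W
    using that(1,2) by induction (use that(3) in auto)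
  \<comment> \<open>Only \<open>(x, y)\<close> can leave \<open>S\<close>, and \<open>x\<close> is
    not in \<open>S'\<close>; symmetrically for \<open>S'\<close>. So no arc leaves
    \<open>S \<inter> S'\<close>, and a path from \<open>z\<close> to \<open>x\<close> would have to
    stay inside it.\<close>
  have disj: "z \<notin> S \<inter> S'"
  proof
    assume "z \<in> S \<inter> S'"
    moreover have "A `` (S \<inter> S') \<subseteq> S \<inter> S'"
      using S_step S'_step notin by blast
    ultimately have "x \<in> S \<inter> S'" by (rule closed[OF strong[OF z(1) V(1)]])
    then show False using notin by blast
  qed
  \<comment> \<open>The two exceptional arcs end at \<open>y\<close>, which is in \<open>S'\<close>,
    and at \<open>x\<close>, which is in \<open>S\<close>.\<close>
  have "A `` (S \<union> S') \<subseteq> S \<union> S'"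
    using S_step S'_step mem by blast
  then have "z \<in> S \<union> S'"
    by (rule closed[OF strong[OF V(1) z(1)] UnI1[OF mem(1)]])
  then show False
  proof
    \<comment> \<open>As \<open>z \<noteq> x\<close>, an arc from \<open>z\<close> to
      \<open>y\<close> would put \<open>y\<close> into \<open>S\<close>, and an arc from
      \<open>y\<close> to \<open>z\<close> would put \<open>z\<close> into \<open>S'\<close>; one of
      them exists.\<close>
    assume "z \<in> S"
    then show False
      using semi[OF z(1) V(2) z(3)] S_step[of z y] S'_step[of y z] z(2) notin(1) mem(2) disj
      by auto
  next
    assume "z \<in> S'"
    then show False
      using semi[OF z(1) V(1) z(2)] S'_step[of z x] S_step[of x z] z(3) notin(2) mem(1) disj
      by auto
  qed
qed

text \<open>2-cycles are destroyed one arc at a time: the opposite arc stays, so semicompleteness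
  survives, and finiteness ends the process. Preserving \<open>A\<^sup>*\<close> itself lets
  successive deletions compose.\<close>

lemma exists_strong_spanning_tournament:
  assumes "finite A" "A \<subseteq> V \<times> V" "3 \<le> card V"
    and "\<And>u v. u \<in> V \<Longrightarrow> v \<in> V \<Longrightarrow> (u, v) \<in> A\<^sup>*"
    and "\<And>u v. u \<in> V \<Longrightarrow> v \<in> V \<Longrightarrow> u \<noteq> v \<Longrightarrow> (u, v) \<in> A \<or> (v, u) \<in> A"
  shows "\<exists>B\<subseteq>A. B\<^sup>* = A\<^sup>* \<and>
    (\<forall>u\<in>V. \<forall>v\<in>V. u \<noteq> v \<longrightarrow> (u, v) \<in> B \<or> (v, u) \<in> B) \<and>
    (\<forall>x y. x \<noteq> y \<longrightarrow> (x, y) \<in> B \<longrightarrow> (y, x) \<notin> B)"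
  using assms(1,2,4,5)
proof (induction A rule: finite_psubset_induct)
  case (psubset A)
  show ?case
  proof (cases "\<exists>x y. x \<noteq> y \<and> (x, y) \<in> A \<and> (y, x) \<in> A")
    case True
    then obtain x y where xy: "x \<noteq> y" "(x, y) \<in> A" "(y, x) \<in> A" by blast
    \<comment> \<open>Three vertices leave one outside the 2-cycle, which the deletion argument
      requires.\<close>
    have "card {x, y} < card V" using assms(3) xy(1) by simp
    then obtain z where z: "z \<in> V" "z \<noteq> x" "z \<noteq> y"
      by (metis card_mono finite.emptyI finite_insert insert_iff not_le subsetI)
    obtain e where e: "e \<in> {(x, y), (y, x)}" "A\<^sup>* = (A - {e})\<^sup>*"
      using two_cycle_arc_deletable[OF psubset.prems(2,1,3) xy(2,3) z] by blast
    have "\<exists>B\<subseteq>A - {e}. B\<^sup>* = (A - {e})\<^sup>* \<and>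
      (\<forall>u\<in>V. \<forall>v\<in>V. u \<noteq> v \<longrightarrow> (u, v) \<in> B \<or> (v, u) \<in> B) \<and>
      (\<forall>x y. x \<noteq> y \<longrightarrow> (x, y) \<in> B \<longrightarrow> (y, x) \<notin> B)"
    proof (rule psubset.IH)
      show "A - {e} \<subset> A" using e(1) xy by blast
      show "A - {e} \<subseteq> V \<times> V" using psubset.prems(1) by blast
      show "(u, v) \<in> (A - {e})\<^sup>*" if "u \<in> V" "v \<in> V" for u v
        using psubset.prems(2)[OF that] e(2) by simp
      show "(u, v) \<in> A - {e} \<or> (v, u) \<in> A - {e}" if "u \<in> V" "v \<in> V" "u \<noteq> v" for u v
        using psubset.prems(3)[OF that] e(1) xy that by blast
    qed
    then show ?thesis unfolding e(2) by (elim ex_forward conj_forward) auto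
  next
    case False
    then show ?thesis using psubset.prems(3) by (intro exI[of _ A]) blast
  qed
qed

section \<open>Strong connectivity of compositions\<close>

text \<open>All arcs join vertices, so the closure relative to the vertex set, by which reachability
  is defined, agrees with \<open>rtrancl\<close> between vertices.\<close>

lemma (in pair_wf_digraph) strongly_connected_iff_rtrancl:
  "strongly_connected (with_proj G) \<longleftrightarrow>
     pverts G \<noteq> {} \<and> (\<forall>u\<in>pverts G. \<forall>v\<in>pverts G. (u, v) \<in> (parcs G)\<^sup>*)"
proof -
  have "(u, v) \<in> rtrancl_on (pverts G) (parcs G) \<longleftrightarrow> (u, v) \<in> (parcs G)\<^sup>*"
    if "u \<in> pverts G" "v \<in> pverts G" for u v
    using that rtrancl_consistent_rtrancl_on[of u v "parcs G" "pverts G"]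
    by (auto intro: rtrancl_on_rtranclI in_arcsD2)
  then show ?thesis unfolding strongly_connected_def reachable_def by simp
qed

lemma composition_simps [simp]:
  "pverts (composition T H) = (\<Union>u\<in>pverts T. pverts (H u))"
  "parcs (composition T H) = (\<Union>u\<in>pverts T. parcs (H u)) \<union>
     {(x, y). \<exists>u v. (u, v) \<in> parcs T \<and> x \<in> pverts (H u) \<and> y \<in> pverts (H v)}"
  by (simp_all add: composition_def)

lemma pair_wf_digraph_composition:
  assumes "pair_wf_digraph T" "\<And>u. u \<in> pverts T \<Longrightarrow> pair_wf_digraph (H u)"
  shows "pair_wf_digraph (composition T H)"
proof
  fix e assume e: "e \<in> parcs (composition T H)"
  then consider u where "u \<in> pverts T" "e \<in> parcs (H u)"
    | u v where "(u, v) \<in> parcs T" "fst e \<in> pverts (H u)" "snd e \<in> pverts (H v)"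
    by auto
  then have "fst e \<in> pverts (composition T H) \<and> snd e \<in> pverts (composition T H)"
  proof cases
    case 1
    then show ?thesis
      using pair_wf_digraph.arc_fst_in_verts[OF assms(2)]
        pair_wf_digraph.arc_snd_in_verts[OF assms(2)] by (simp, blast)
  next
    case 2
    then show ?thesis
      using pair_wf_digraph.in_arcsD1[OF assms(1)] pair_wf_digraph.in_arcsD2[OF assms(1)] by auto
  qed
  then show "fst e \<in> pverts (composition T H)" "snd e \<in> pverts (composition T H)" by auto
qed

lemma semicomplete_compositionD:
  assumes "semicomplete_composition T H"
  shows "pair_digraph T" "pair_wf_digraph T" "2 \<le> card (pverts T)"
    and "u \<in> pverts T \<Longrightarrow> pair_wf_digraph (H u)"
    and "u \<in> pverts T \<Longrightarrow> pverts (H u) \<noteq> {}"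
    and "u \<in> pverts T \<Longrightarrow> v \<in> pverts T \<Longrightarrow> x \<in> pverts (H u) \<Longrightarrow> x \<in> pverts (H v) \<Longrightarrow> u = v"
    and "u \<in> pverts T \<Longrightarrow> v \<in> pverts T \<Longrightarrow> u \<noteq> v \<Longrightarrow> (u, v) \<in> parcs T \<or> (v, u) \<in> parcs T"
    and "pair_wf_digraph (composition T H)"
proof -
  show T: "pair_digraph T" "2 \<le> card (pverts T)"
    and "u \<in> pverts T \<Longrightarrow> pverts (H u) \<noteq> {}"
    and "u \<in> pverts T \<Longrightarrow> v \<in> pverts T \<Longrightarrow> u \<noteq> v \<Longrightarrow> (u, v) \<in> parcs T \<or> (v, u) \<in> parcs T"
    using assms unfolding semicomplete_composition_def semicomplete_def by auto
  show "u \<in> pverts T \<Longrightarrow> v \<in> pverts T \<Longrightarrow> x \<in> pverts (H u) \<Longrightarrow> x \<in> pverts (H v) \<Longrightarrow> u = v"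
    using assms unfolding semicomplete_composition_def disjoint_family_on_def by blast
  show T_wf: "pair_wf_digraph T"
    using T(1) by (simp add: pair_digraph_def pair_fin_digraph_def)
  have H_wf: "pair_wf_digraph (H u)" if "u \<in> pverts T" for u
    using assms that
    by (auto simp: semicomplete_composition_def pair_digraph_def pair_fin_digraph_def)
  then show "u \<in> pverts T \<Longrightarrow> pair_wf_digraph (H u)" .
  show "pair_wf_digraph (composition T H)"
    using T_wf H_wf by (rule pair_wf_digraph_composition)
qed

text \<open>Along a path, an arc inside a part projects to no move in \<open>T\<close>, and an arc
  between parts projects to an arc of \<open>T\<close>; disjointness makes consecutive projections
  fit together.\<close>

lemma composition_path_projects:
  assumes sc: "semicomplete_composition T H"
    and "(x, y) \<in> (parcs (composition T H))\<^sup>*" "u \<in> pverts T" "x \<in> pverts (H u)"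
  shows "\<exists>v\<in>pverts T. y \<in> pverts (H v) \<and> (u, v) \<in> (parcs T)\<^sup>*"
  using assms(2)
proof induction
  case base
  then show ?case using assms(3,4) by blast
next
  case (step y z)
  note D = semicomplete_compositionD[OF sc]
  obtain v where v: "v \<in> pverts T" "y \<in> pverts (H v)" "(u, v) \<in> (parcs T)\<^sup>*"
    using step.IH by blast
  from step.hyps(2) consider w where "w \<in> pverts T" "(y, z) \<in> parcs (H w)"
    | a b where "(a, b) \<in> parcs T" "y \<in> pverts (H a)" "z \<in> pverts (H b)"
    by auto
  then show ?case
  proof cases
    case 1
    then have "y \<in> pverts (H w)" "z \<in> pverts (H w)"
      using pair_wf_digraph.in_arcsD1[OF D(4)] pair_wf_digraph.in_arcsD2[OF D(4)] by auto
    then show ?thesis using v 1(1) D(6) by blast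
  next
    case 2
    have ab: "a \<in> pverts T" "b \<in> pverts T"
      using 2(1) pair_wf_digraph.in_arcsD1[OF D(2)] pair_wf_digraph.in_arcsD2[OF D(2)] by auto
    then have "a = v" using D(6) 2(2) v by blast
    then show ?thesis using ab 2 v(3) by (blast intro: rtrancl_into_rtrancl)
  qed
qed

text \<open>An arc of \<open>T\<close> joins every vertex of one part to every vertex of the other,
  so the endpoints are free and nonempty parts supply the inner vertices. \<open>trancl\<close>
  matters: the empty path at \<open>u\<close> does not connect distinct vertices of
  \<open>H u\<close>.\<close>

lemma composition_path_lifts:
  assumes sc: "semicomplete_composition T H"
    and "(u, v) \<in> (parcs T)\<^sup>+" "x \<in> pverts (H u)" "y \<in> pverts (H v)"
  shows "(x, y) \<in> (parcs (composition T H))\<^sup>+"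
  using assms(2,4)
proof (induction arbitrary: y)
  case (base v)
  then show ?case using assms(3) by auto
next
  case (step v w)
  note D = semicomplete_compositionD[OF sc]
  have "v \<in> pverts T" using step.hyps(2) pair_wf_digraph.in_arcsD1[OF D(2)] by blast
  then obtain z where z: "z \<in> pverts (H v)" using D(5) by blast
  have "(z, y) \<in> parcs (composition T H)" using z step by auto
  then show ?case using step.IH[OF z] by (rule trancl_into_trancl[rotated])
qed

lemma strongly_connected_composition_iff:
  assumes sc: "semicomplete_composition T H"
  shows "strongly_connected (with_proj (composition T H)) \<longleftrightarrow> strongly_connected (with_proj T)"
proof -
  note D = semicomplete_compositionD[OF sc]
  have T_ne: "pverts T \<noteq> {}" using D(3) by auto
  then have Q_ne: "pverts (composition T H) \<noteq> {}" using D(5) by auto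
  have "(\<forall>x\<in>pverts (composition T H). \<forall>y\<in>pverts (composition T H).
           (x, y) \<in> (parcs (composition T H))\<^sup>*) \<longleftrightarrow>
        (\<forall>u\<in>pverts T. \<forall>v\<in>pverts T. (u, v) \<in> (parcs T)\<^sup>*)" (is "?Q \<longleftrightarrow> ?T")
  proof
    assume Q: ?Q
    show ?T
    proof (intro ballI)
      fix u v assume uv: "u \<in> pverts T" "v \<in> pverts T"
      then obtain x y where xy: "x \<in> pverts (H u)" "y \<in> pverts (H v)" using D(5) by blast
      then have "(x, y) \<in> (parcs (composition T H))\<^sup>*" using Q uv by auto
      from composition_path_projects[OF sc this uv(1) xy(1)]
      show "(u, v) \<in> (parcs T)\<^sup>*" using D(6) uv xy by blast
    qed
  next
    assume T: ?T
    \<comment> \<open>Connecting two vertices of the same part takes a nonempty closed walk at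
      \<open>u\<close>: go to a second vertex of \<open>T\<close> and return.\<close>
    have trancl: "(u, v) \<in> (parcs T)\<^sup>+" if uv: "u \<in> pverts T" "v \<in> pverts T" for u v
    proof (cases "u = v")
      case True
      have "\<not> pverts T \<subseteq> {u}" using D(3) card_mono[of "{u}" "pverts T"] by auto
      then obtain w where "w \<in> pverts T" "w \<noteq> u" by blast
      then have "(u, w) \<in> (parcs T)\<^sup>+" "(w, u) \<in> (parcs T)\<^sup>+"
        using T uv by (metis rtranclD)+
      then show ?thesis using True by simp
    qed (use T uv in \<open>metis rtranclD\<close>)
    show ?Q
    proof (intro ballI)
      fix x y assume "x \<in> pverts (composition T H)" "y \<in> pverts (composition T H)"
      then obtain u v where "u \<in> pverts T" "x \<in> pverts (H u)" "v \<in> pverts T" "y \<in> pverts (H v)"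
        by auto
      then show "(x, y) \<in> (parcs (composition T H))\<^sup>*"
        using composition_path_lifts[OF sc trancl] by (blast intro: trancl_into_rtrancl)
    qed
  qed
  then show ?thesis
    using T_ne Q_ne pair_wf_digraph.strongly_connected_iff_rtrancl[OF D(2)]
      pair_wf_digraph.strongly_connected_iff_rtrancl[OF D(8)] by blast
qed

section \<open>Two parts versus three or more\<close>

lemma strong_composition_two_parts_has_two_cycle:
  assumes sc: "semicomplete_composition T H"
    and strong: "strongly_connected (with_proj (composition T H))"
    and two: "card (pverts T) = 2"
  shows "has_two_cycle (composition T H)"
proof -
  note D = semicomplete_compositionD[OF sc]
  obtain a b where ab: "pverts T = {a, b}" "a \<noteq> b" using two by (meson card_2_iff)
  have T: "(u, v) \<in> (parcs T)\<^sup>*" if "u \<in> pverts T" "v \<in> pverts T" for u v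
    using that strong strongly_connected_composition_iff[OF sc]
      pair_wf_digraph.strongly_connected_iff_rtrancl[OF D(2)] by blast
  have arc: "(u, v) \<in> parcs T" if uv: "pverts T = {u, v}" "u \<noteq> v" for u v
  proof -
    have "(u, v) \<in> (parcs T)\<^sup>*" using T uv by blast
    \<comment> \<open>The first arc of a path from \<open>u\<close> to \<open>v\<close> leaves
      \<open>u\<close>; without loops it can only go to \<open>v\<close>.\<close>
    then obtain w where w: "(u, w) \<in> parcs T" using uv(2) by (meson converse_rtranclE)
    have "w \<in> pverts T" using w pair_wf_digraph.in_arcsD2[OF D(2)] by blast
    moreover have "w \<noteq> u"
      using w D(1) pair_loopfree_digraph.pair_no_loops[of T "(u, w)"]
      by (auto simp: pair_digraph_def)
    ultimately show ?thesis using uv w by blast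
  qed
  have arcs: "(a, b) \<in> parcs T" "(b, a) \<in> parcs T" using arc ab by blast+
  obtain x y where xy: "x \<in> pverts (H a)" "y \<in> pverts (H b)"
    using D(5)[of a] D(5)[of b] ab(1) by auto
  then have "x \<noteq> y" using D(6)[of a b x] ab by blast
  moreover have "(x, y) \<in> parcs (composition T H)" "(y, x) \<in> parcs (composition T H)"
    using arcs xy by auto
  ultimately show ?thesis unfolding has_two_cycle_def by blast
qed

lemma exists_strong_spanning_composition_without_two_cycle:
  fixes T :: "'b pair_pre_digraph" and H :: "'b \<Rightarrow> 'a pair_pre_digraph"
  assumes sc: "semicomplete_composition T H"
    and strong: "strongly_connected (with_proj (composition T H))"
    and three: "3 \<le> card (pverts T)"
  shows "\<exists>(T' :: 'b pair_pre_digraph) (H' :: 'b \<Rightarrow> 'a pair_pre_digraph).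
            spanning_semicomplete_composition T' H' T H \<and>
            strongly_connected (with_proj (composition T' H')) \<and>
            \<not> has_two_cycle (composition T' H')"
proof -
  note D = semicomplete_compositionD[OF sc]
  interpret T: pair_digraph T by (rule D(1))
  have reach: "(u, v) \<in> (parcs T)\<^sup>*" if "u \<in> pverts T" "v \<in> pverts T" for u v
    using that strong strongly_connected_composition_iff[OF sc]
      pair_wf_digraph.strongly_connected_iff_rtrancl[OF D(2)] by blast
  have "parcs T \<subseteq> pverts T \<times> pverts T" by (auto dest: T.in_arcsD1 T.in_arcsD2)
  from exists_strong_spanning_tournament[OF T.pair_finite_arcs this three reach D(7)]
  obtain B where B: "B \<subseteq> parcs T" "B\<^sup>* = (parcs T)\<^sup>*"
    "\<forall>u\<in>pverts T. \<forall>v\<in>pverts T. u \<noteq> v \<longrightarrow> (u, v) \<in> B \<or> (v, u) \<in> B"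
    "\<forall>x y. x \<noteq> y \<longrightarrow> (x, y) \<in> B \<longrightarrow> (y, x) \<notin> B"
    by blast
  define T' where "T' = \<lparr>pverts = pverts T, parcs = B\<rparr>"
  \<comment> \<open>Arcless parts leave only arcs induced by \<open>B\<close>, and strong
    connectivity depends on \<open>T'\<close> alone.\<close>
  define H' where "H' = (\<lambda>u. \<lparr>pverts = pverts (H u), parcs = {}\<rparr>)"
  have T'_dig: "pair_digraph T'"
  proof
    show "finite (parcs T')"
      using B(1) T.pair_finite_arcs by (simp add: T'_def finite_subset)
    fix e assume "e \<in> parcs T'"
    then have "e \<in> parcs T" using B(1) by (auto simp: T'_def)
    then show "fst e \<in> pverts T'" "snd e \<in> pverts T'" "fst e \<noteq> snd e"
      using T.arc_fst_in_verts T.arc_snd_in_verts T.pair_no_loops by (auto simp: T'_def)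
  qed (simp add: T'_def T.pair_finite_verts)
  have H'_dig: "pair_digraph (H' u)" if "u \<in> pverts T" for u
  proof -
    have "pair_digraph (H u)" using sc that by (auto simp: semicomplete_composition_def)
    then have "finite (pverts (H u))"
      by (simp add: pair_digraph_def pair_fin_digraph.pair_finite_verts)
    then show ?thesis by unfold_locales (auto simp: H'_def)
  qed
  have sc': "semicomplete_composition T' H'"
    using sc T'_dig H'_dig B(3)
    unfolding semicomplete_composition_def semicomplete_def by (auto simp: T'_def H'_def)
  note D' = semicomplete_compositionD[OF sc']
  have "strongly_connected (with_proj T')"
    using pair_wf_digraph.strongly_connected_iff_rtrancl[OF D'(2)] reach B(2) D(3)
    by (auto simp: T'_def)
  then have "strongly_connected (with_proj (composition T' H'))"
    using strongly_connected_composition_iff[OF sc'] by blast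
  moreover have "spanning_semicomplete_composition T' H' T H"
  proof -
    interpret Q: pair_wf_digraph "composition T H" by (rule D(8))
    interpret Q': pair_wf_digraph "composition T' H'" by (rule D'(8))
    have "spanning (with_proj (composition T' H')) (with_proj (composition T H))"
      unfolding spanning_def subgraph_def
      using B(1) Q.wf_digraph_axioms Q'.wf_digraph_axioms
      by (auto simp: T'_def H'_def compatible_def)
    then show ?thesis
      using sc' by (simp add: spanning_semicomplete_composition_def T'_def)
  qed
  moreover have "\<not> has_two_cycle (composition T' H')"
  proof
    assume "has_two_cycle (composition T' H')"
    then obtain x y a b c d where
      "(a, b) \<in> B" "x \<in> pverts (H a)" "y \<in> pverts (H b)"
      "(c, d) \<in> B" "y \<in> pverts (H c)" "x \<in> pverts (H d)"
      unfolding has_two_cycle_def by (auto simp: T'_def H'_def)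
    \<comment> \<open>Each of \<open>x\<close> and \<open>y\<close> determines its part, so a
      2-cycle in the composition would come from a 2-cycle in \<open>B\<close>.\<close>
    moreover from this have "a = d" "b = c" "a \<noteq> b"
      using D(6) B(1) T.in_arcsD1 T.in_arcsD2 T.pair_no_loops by (blast, blast, fastforce)
    ultimately show False using B(4) by blast
  qed
  ultimately show ?thesis by blast
qed

theorem theorem5p3:
  fixes T :: "'b pair_pre_digraph" and H :: "'b \<Rightarrow> 'a pair_pre_digraph"
  assumes "semicomplete_composition T H"
    and "strongly_connected (with_proj (composition T H))"
  shows "(\<exists>(T' :: 'b pair_pre_digraph) (H' :: 'b \<Rightarrow> 'a pair_pre_digraph).
            spanning_semicomplete_composition T' H' T H \<and>
            strongly_connected (with_proj (composition T' H')) \<and>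
            \<not> has_two_cycle (composition T' H'))
         \<longleftrightarrow> 3 \<le> card (pverts T)" (is "?L \<longleftrightarrow> ?R")
proof
  assume ?L
  then obtain T' :: "'b pair_pre_digraph" and H' :: "'b \<Rightarrow> 'a pair_pre_digraph"
    where "semicomplete_composition T' H'" "card (pverts T') = card (pverts T)"
      "strongly_connected (with_proj (composition T' H'))"
      "\<not> has_two_cycle (composition T' H')"
    unfolding spanning_semicomplete_composition_def by blast
  \<comment> \<open>The two-part result is applied to \<open>T'\<close> and \<open>H'\<close>, whose
    number of parts equals that of \<open>T\<close>.\<close>
  then have "card (pverts T) \<noteq> 2"
    using strong_composition_two_parts_has_two_cycle by force
  then show ?R using semicomplete_compositionD(3)[OF assms(1)] by linarith
next
  assume ?R
  then show ?L
    by (rule exists_strong_spanning_composition_without_two_cycle[OF assms])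
qed

end
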